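(* Let $P=\binom{p+d}{d}$ and assume that the number of samples $N$ satisfies $N=O(P^k)$ for some $k>0$. Let $V(r,d)=(r\sqrt{\pi})^d/\Gamma(d/2+1)$ denote the volume inside the hypersphere of radius $r$ in dimension $d$. Then there is a sequence $\epsilon_p$, with $\epsilon_p\to0$ if $d=o(p)$, such that the following holds for the $d$-dimensional orthonormal Hermite polynomials of total order at most $p$. If $\bm{Y}$ is sampled uniformly from the $d$-dimensional ball centered at the origin of radius $\sqrt{2}\sqrt{(2+\epsilon_p)p+1}$, and the polynomials $\psi_k$ are weighted on this ball by the normalized weight function proportional to $\exp(-\|\bm{\xi}\|_2^2/4)$, then the coherence parameter satisfies $$\mu(\bm{Y})=O\big(\pi^{-d/2}V(\sqrt{2p},d)\big)=O\big((2p)^{d/2}/\Gamma(d/2+1)\big).$$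
   Context: Let $f(\bm{\xi})=(2\pi)^{-d/2}\exp(-\|\bm{\xi}\|_2^2/2)$ on $\mathbb{R}^d$. For a multi-index $\bm{k}=(k_1,\dots,k_d)$ of nonnegative integers set $\psi_{\bm{k}}(\bm{\xi})=\prod_{i=1}^d\psi_{k_i}(\xi_i)$, where $\psi_j$ is the univariate (probabilists') Hermite polynomial of degree $j$, normalized to be orthonormal with respect to the standard normal density. The polynomials of total order at most $p$ are those with $\|\bm{k}\|_1\le p$; there are $P=\binom{p+d}{d}$ of them, indexed also as $\psi_1,\dots,\psi_P$. Sampling scheme and weight normalization: given a set $\mathcal{S}$ and a positive function $G$ on $\mathcal{S}$, put $c=\big(\int_{\mathcal{S}}f(\bm{\xi})G^2(\bm{\xi})\,d\bm{\xi}\big)^{-1/2}$; then $\bm{Y}$ has density $c^2f(\bm{\xi})G^2(\bm{\xi})$ on $\mathcal{S}$ and the weight function is $w(\bm{\xi})=1/(cG(\bm{\xi}))$. Here $\mathcal{S}$ is the ball of radius $R=\sqrt{2}\sqrt{(2+\epsilon_p)p+1}$ and $G(\bm{\xi})=\exp(\|\bm{\xi}\|_2^2/4)$, so that $\bm{Y}$ is uniform on the ball and $w(\bm{\xi})=c^{-1}\exp(-\|\bm{\xi}\|_2^2/4)$ with $c^{-2}=(2\pi)^{-d/2}V(R,d)$. Coherence parameter: for a random vector $\bm{Y}$ from which $N$ independent samples are taken, and a weight function $w$, $$\mu(\bm{Y}):=\min_{\mathcal{S}}\Big\{\sup_{k=1,\dots,P,\ \bm{\xi}\in\mathcal{S}}|w(\bm{\xi})\psi_k(\bm{\xi})|^2\Big\}$$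 where the minimum is over subsets $\mathcal{S}$ of the support of $f$ subject to $$\mathbb{P}(\mathcal{S}^c)<\frac{1}{NP},\qquad \sum_{k=1}^P\mathbb{E}\big[|w(\bm{Y})\psi_k(\bm{Y})|^2\mathbf{1}_{\mathcal{S}^c}\big]\le\frac{1}{20}P^{-1/2}.$$ Here $\mathbb{P}(\mathcal{S}^c)$ is the probability that the sampled vector lies in $\mathcal{S}^c$. The $O(\cdot)$ statements are asymptotic as $p\to\infty$. *)

theory Defs
  imports "HOL-Probability.Probability" "HOL-Library.Landau_Symbols"
begin

subsection \<open>Orthonormal Hermite polynomials\<close>

text \<open>The monic (probabilists') Hermite polynomials.\<close>

fun Hermite :: "nat \<Rightarrow> real poly" where
  "Hermite 0 = 1"
| "Hermite (Suc 0) = [:0, 1:]"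
| "Hermite (Suc (Suc n)) = [:0, 1:] * Hermite (Suc n) - smult (real (Suc n)) (Hermite n)"

definition psi :: "nat \<Rightarrow> real \<Rightarrow> real" where
  "psi j x = poly (Hermite j) x / sqrt (fact j)"

text \<open>The lemmas \<open>degree_Hermite\<close> and \<open>psi_orthonormal\<close> justify the recurrence and the factor
  \<open>sqrt (fact j)\<close>: \<open>psi j\<close> has degree \<open>j\<close>, and the family is orthonormal with respect to the
  standard normal density.\<close>

lemma degree_Hermite: "degree (Hermite n) = n \<and> coeff (Hermite n) n = 1"
proof (induction n rule: Hermite.induct)
  case (3 n)
  have nz: "Hermite (Suc n) \<noteq> 0" using 3 by auto
  have deg: "degree ([:0, 1:] * Hermite (Suc n)) = Suc (Suc n)"
    using 3 nz by (simp add: degree_mult_eq)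
  have lt: "degree (smult (real (Suc n)) (Hermite n)) < Suc (Suc n)"
    using 3 by simp
  have "degree (Hermite (Suc (Suc n))) = Suc (Suc n)"
    using degree_add_eq_left[of "- smult (real (Suc n)) (Hermite n)" "[:0, 1:] * Hermite (Suc n)"]
      deg lt by simp
  moreover have "coeff (Hermite (Suc (Suc n))) (Suc (Suc n)) = 1"
    using 3 lt by (simp add: coeff_eq_0)
  ultimately show ?case by blast
qed auto

definition gauss_mean :: "real poly \<Rightarrow> real" where
  "gauss_mean q = (\<integral>x. std_normal_density x * poly q x \<partial>lborel)"

lemma integrable_gauss_poly: "integrable lborel (\<lambda>x. std_normal_density x * poly q x)"
proof -
  have "integrable lborel (\<lambda>x. \<Sum>i\<le>degree q. coeff q i * (std_normal_density x * x ^ i))"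
    by (intro Bochner_Integration.integrable_sum integrable_mult_right integrable_std_normal_moment)
  then show ?thesis
    by (simp add: poly_altdef sum_distrib_left mult_ac)
qed

lemma gauss_mean_add: "gauss_mean (p + q) = gauss_mean p + gauss_mean q"
  unfolding gauss_mean_def
  by (simp add: distrib_left integrable_gauss_poly Bochner_Integration.integral_add)

lemma gauss_mean_diff: "gauss_mean (p - q) = gauss_mean p - gauss_mean q"
  unfolding gauss_mean_def
  by (simp add: right_diff_distrib integrable_gauss_poly Bochner_Integration.integral_diff)

lemma gauss_mean_smult: "gauss_mean (smult c q) = c * gauss_mean q"
proof -
  have "(\<lambda>x. std_normal_density x * poly (smult c q) x)
      = (\<lambda>x. c * (std_normal_density x * poly q x))"
    by (simp add: mult_ac)
  then show ?thesis unfolding gauss_mean_def by simp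
qed

lemma gauss_mean_monom_even: "gauss_mean (monom 1 (2 * k)) = fact (2 * k) / (2 ^ k * fact k)"
  by (simp add: gauss_mean_def poly_monom integral_std_normal_moment_even)

lemma gauss_mean_monom_odd: "gauss_mean (monom 1 (2 * k + 1)) = 0"
  using integral_std_normal_moment_odd[of k] by (simp add: gauss_mean_def poly_monom)

lemma gauss_mean_monom_parts:
  "gauss_mean (monom 1 (Suc n)) = gauss_mean (pderiv (monom 1 n))"
proof (cases "even n")
  case True
  then obtain k where n: "n = 2 * k" by (elim evenE)
  have "gauss_mean (monom 1 (n - 1)) = 0 \<or> n = 0"
    using gauss_mean_monom_odd[of "k - 1"] n by (cases k) auto
  moreover have "pderiv (monom 1 n) = smult (real n) (monom 1 (n - 1))"
    by (simp add: pderiv_monom smult_monom)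
  ultimately show ?thesis
    using gauss_mean_monom_odd[of k] n by (auto simp: gauss_mean_smult)
next
  case False
  then obtain k where n: "n = 2 * k + 1" by (elim oddE)
  have "gauss_mean (monom 1 (Suc n)) = fact (2 * Suc k) / (2 ^ Suc k * fact (Suc k))"
    using gauss_mean_monom_even[of "Suc k"] n by simp
  also have "\<dots> = real n * (fact (2 * k) / (2 ^ k * fact k))"
  proof -
    have "(fact (2 * Suc k) :: real) = 2 * real (Suc k) * (real n * fact (2 * k))"
      using n by (simp add: algebra_simps)
    moreover have "(2 ^ Suc k * fact (Suc k) :: real) = 2 * real (Suc k) * (2 ^ k * fact k)"
      by (simp add: algebra_simps)
    ultimately show ?thesis by (simp only: mult_divide_mult_cancel_left_if) simp
  qed
  also have "\<dots> = gauss_mean (smult (real n) (monom 1 (n - 1)))"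
    using n by (simp add: gauss_mean_smult gauss_mean_monom_even)
  finally show ?thesis by (simp add: pderiv_monom smult_monom)
qed

lemma gauss_mean_parts: "gauss_mean ([:0, 1:] * q) = gauss_mean (pderiv q)"
proof -
  have single: "gauss_mean ([:0, 1:] * monom c i) = gauss_mean (pderiv (monom c i))" for c i
  proof -
    have "[:0, 1:] * monom c i = smult c (monom 1 (Suc i))"
      by (simp add: smult_monom monom_Suc)
    moreover have "pderiv (monom c i) = smult c (pderiv (monom 1 i))"
      by (simp add: pderiv_monom smult_monom mult_ac)
    ultimately show ?thesis by (simp only: gauss_mean_smult gauss_mean_monom_parts)
  qed
  have "gauss_mean ([:0, 1:] * (\<Sum>i\<le>n. monom (coeff q i) i))
      = gauss_mean (pderiv (\<Sum>i\<le>n. monom (coeff q i) i))" for n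
  proof (induction n)
    case 0
    show ?case using single[of "coeff q 0" 0] by simp
  next
    case (Suc n)
    then show ?case
      using single[of "coeff q (Suc n)" "Suc n"]
      by (simp only: sum.atMost_Suc distrib_left gauss_mean_add pderiv_add)
  qed
  from this[of "degree q"] show ?thesis by (simp only: poly_as_sum_of_monoms)
qed

lemma pderiv_Hermite: "pderiv (Hermite (Suc n)) = smult (real (Suc n)) (Hermite n)"
proof (induction n rule: less_induct)
  case (less n)
  show ?case
  proof (cases n)
    case 0
    then show ?thesis by (simp add: pderiv_pCons)
  next
    case (Suc m)
    have a: "pderiv (Hermite (Suc m)) = smult (real (Suc m)) (Hermite m)"
      using less Suc by simp
    have b: "[:0, 1:] * Hermite m - pderiv (Hermite m) = Hermite (Suc m)"
    proof (cases m)
      case (Suc l)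
      then have "pderiv (Hermite m) = smult (real m) (Hermite l)"
        using less \<open>n = Suc m\<close> by simp
      then show ?thesis using Suc by simp
    qed simp
    have "pderiv (Hermite (Suc n)) = [:0, 1:] * pderiv (Hermite (Suc m)) + Hermite (Suc m)
        - smult (real (Suc m)) (pderiv (Hermite m))"
      by (simp add: Suc pderiv_diff pderiv_mult pderiv_smult pderiv_pCons)
    also have "\<dots> = Hermite (Suc m) + smult (real (Suc m)) ([:0, 1:] * Hermite m - pderiv (Hermite m))"
      unfolding a by (simp add: smult_diff_right mult_smult_right)
    also have "\<dots> = smult (real (Suc n)) (Hermite n)"
    proof -
      have "smult (real (Suc n)) X = X + smult (real n) X" for X
        using smult_add_left[of 1 "real n" X] by simp
      then show ?thesis unfolding b by (simp only: Suc)
    qed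
    finally show ?thesis .
  qed
qed

lemma gauss_mean_Hermite_Suc:
  "gauss_mean (Hermite (Suc n) * q) = gauss_mean (Hermite n * pderiv q)"
proof (cases n)
  case 0
  then show ?thesis using gauss_mean_parts[of q] by simp
next
  case (Suc m)
  have "gauss_mean (Hermite (Suc n) * q)
      = gauss_mean ([:0, 1:] * (Hermite n * q) - smult (real n) (Hermite m * q))"
    using Suc by (simp add: left_diff_distrib mult_smult_left mult.assoc)
  also have "\<dots> = gauss_mean (Hermite n * pderiv q + q * pderiv (Hermite n))
      - gauss_mean (smult (real n) (Hermite m * q))"
    by (simp only: gauss_mean_diff gauss_mean_parts pderiv_mult)
  also have "\<dots> = gauss_mean (Hermite n * pderiv q)"
    unfolding Suc pderiv_Hermite
    by (simp add: gauss_mean_add gauss_mean_smult mult.commute)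
  finally show ?thesis .
qed

lemma gauss_mean_Hermite: "gauss_mean (Hermite m * Hermite n) = (if m = n then fact n else 0)"
proof (induction m arbitrary: n)
  case 0
  show ?case
  proof (cases n)
    case 0
    then show ?thesis using gauss_mean_monom_even[of 0] by simp
  next
    case (Suc l)
    have "gauss_mean (Hermite n * 1) = gauss_mean 0"
      unfolding Suc gauss_mean_Hermite_Suc by (simp add: pderiv_1)
    then show ?thesis using Suc by (simp add: gauss_mean_def)
  qed
next
  case (Suc m)
  show ?case
  proof (cases n)
    case 0
    have "gauss_mean (Hermite (Suc m) * 1) = gauss_mean 0"
      unfolding gauss_mean_Hermite_Suc by (simp add: pderiv_1)
    then show ?thesis using 0 by (simp add: gauss_mean_def)
  next
    case (Suc l)
    have "gauss_mean (Hermite (Suc m) * Hermite (Suc l))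
        = real (Suc l) * gauss_mean (Hermite m * Hermite l)"
      unfolding gauss_mean_Hermite_Suc pderiv_Hermite
      by (simp only: mult_smult_right gauss_mean_smult)
    then show ?thesis using Suc.IH[of l] Suc by simp
  qed
qed

lemma psi_orthonormal:
  "(\<integral>x. std_normal_density x * (psi m x * psi n x) \<partial>lborel) = (if m = n then 1 else 0)"
proof -
  have "(\<integral>x. std_normal_density x * (psi m x * psi n x) \<partial>lborel)
      = (\<integral>x. std_normal_density x * poly (Hermite m * Hermite n) x
            / (sqrt (fact m) * sqrt (fact n)) \<partial>lborel)"
    by (intro Bochner_Integration.integral_cong) (auto simp: psi_def)
  also have "\<dots> = gauss_mean (Hermite m * Hermite n) / (sqrt (fact m) * sqrt (fact n))"
    unfolding gauss_mean_def by simp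
  finally show ?thesis by (simp add: gauss_mean_Hermite)
qed


subsection \<open>Tensor products of total order at most \<open>p\<close>\<close>

text \<open>Since the dimension may depend on \<open>p\<close>, a point of \<open>d\<close>-dimensional space is a function on
  \<open>{..<d}\<close>, extended by \<^term>\<open>undefined\<close>, as in the library's product measures.\<close>

abbreviation lebesgue_n :: "nat \<Rightarrow> (nat \<Rightarrow> real) measure" where
  "lebesgue_n d \<equiv> Pi\<^sub>M {..<d} (\<lambda>_. lborel)"

definition multi_indices :: "nat \<Rightarrow> nat \<Rightarrow> (nat \<Rightarrow> nat) set" where
  "multi_indices d p = {k \<in> {..<d} \<rightarrow>\<^sub>E UNIV. (\<Sum>i<d. k i) \<le> p}"

definition psi_n :: "nat \<Rightarrow> (nat \<Rightarrow> nat) \<Rightarrow> (nat \<Rightarrow> real) \<Rightarrow> real" where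
  "psi_n d k \<xi> = (\<Prod>i<d. psi (k i) (\<xi> i))"

lemma card_multi_indices: "card (multi_indices d p) = (p + d) choose d"
proof -
  define L where "L = {l::nat list. length l = Suc d \<and> sum_list l = p}"
  define g where "g k = (p - (\<Sum>i<d. k i)) # map k [0..<d]" for k :: "nat \<Rightarrow> nat"
  have sl: "sum_list (map k [0..<d]) = (\<Sum>i<d. k i)" for k :: "nat \<Rightarrow> nat"
    by (simp add: interv_sum_list_conv_sum_set_nat atLeast0LessThan)
  have "bij_betw g (multi_indices d p) L"
  proof (rule bij_betw_imageI)
    show "inj_on g (multi_indices d p)"
    proof (rule inj_onI)
      fix k k' assume k: "k \<in> multi_indices d p" "k' \<in> multi_indices d p" and eq: "g k = g k'"
      have "map k [0..<d] = map k' [0..<d]"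
        using eq unfolding g_def by (rule list.inject[THEN iffD1, THEN conjunct2])
      then have "\<forall>i\<in>set [0..<d]. k i = k' i" by (simp only: map_eq_conv)
      then have eqi: "k i = k' i" if "i \<in> {..<d}" for i using that by simp
      have "k \<in> {..<d} \<rightarrow>\<^sub>E UNIV" "k' \<in> {..<d} \<rightarrow>\<^sub>E UNIV"
        using k unfolding multi_indices_def by blast+
      then show "k = k'" by (rule PiE_ext) (rule eqi)
    qed
    show "g ` multi_indices d p = L"
    proof (intro equalityI subsetI)
      fix l assume "l \<in> g ` multi_indices d p"
      then obtain k where k: "(\<Sum>i<d. k i) \<le> p" "l = g k"
        unfolding multi_indices_def by blast
      have "sum_list l = (p - (\<Sum>i<d. k i)) + (\<Sum>i<d. k i)"
        unfolding k(2) g_def sum_list.Cons sl ..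
      also have "\<dots> = p" using k(1) by (rule le_add_diff_inverse2)
      finally have "sum_list l = p" .
      moreover have "length l = Suc d"
        unfolding k(2) g_def by simp
      ultimately show "l \<in> L" unfolding L_def by blast
    next
      fix l assume l: "l \<in> L"
      then have "length l = Suc d" "sum_list l = p" unfolding L_def by blast+
      then obtain a m where am: "l = a # m" "length m = d" "a + sum_list m = p"
        by (cases l) simp_all
      define k where "k = (\<lambda>i\<in>{..<d}. m ! i)"
      have m: "map k [0..<d] = m"
        using am by (auto simp: k_def intro!: nth_equalityI)
      then have s: "(\<Sum>i<d. k i) = sum_list m" using sl[of k] by simp
      have "k \<in> multi_indices d p"
      proof -
        have "k \<in> {..<d} \<rightarrow>\<^sub>E UNIV" unfolding k_def by simp
        moreover have "(\<Sum>i<d. k i) \<le> p" using am(3) unfolding s by linarith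
        ultimately show ?thesis unfolding multi_indices_def by blast
      qed
      moreover have "g k = l"
        using am(3) unfolding g_def m s am(1) by simp
      ultimately show "l \<in> g ` multi_indices d p" by blast
    qed
  qed
  then have "card (multi_indices d p) = card L" by (rule bij_betw_same_card)
  also have "\<dots> = (p + d) choose p"
    unfolding L_def by (simp only: card_length_sum_list) simp
  also have "\<dots> = (p + d) choose d"
    using binomial_symmetric[of p "p + d"] by simp
  finally show ?thesis .
qed


subsection \<open>Sampling and coherence\<close>

definition gauss_density :: "nat \<Rightarrow> (nat \<Rightarrow> real) \<Rightarrow> real" where
  "gauss_density d \<xi> = (2 * pi) powr (- (real d / 2)) * exp (- ((L2_set \<xi> {..<d})\<^sup>2 / 2))"

definition ball_n :: "nat \<Rightarrow> real \<Rightarrow> (nat \<Rightarrow> real) set" where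
  "ball_n d r = {\<xi> \<in> space (lebesgue_n d). L2_set \<xi> {..<d} \<le> r}"

text \<open>The volume \<open>V(r,d)\<close> of \<^term>\<open>ball_n d r\<close>.\<close>

definition ball_vol :: "real \<Rightarrow> nat \<Rightarrow> real" where
  "ball_vol r d = (r * sqrt pi) ^ d / Gamma (real d / 2 + 1)"

definition normalizer :: "nat \<Rightarrow> (nat \<Rightarrow> real) set \<Rightarrow> ((nat \<Rightarrow> real) \<Rightarrow> real) \<Rightarrow> real" where
  "normalizer d S G =
     (\<integral>\<xi>\<in>S. gauss_density d \<xi> * (G \<xi>)\<^sup>2 \<partial>lebesgue_n d) powr (- 1 / 2)"

text \<open>The weight belonging to the density \<open>c\<^sup>2 f G\<^sup>2\<close> on \<open>S\<close>. The formula is used off \<open>S\<close> as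
  well; this does not influence the coherence of a vector with values in \<open>S\<close>, because replacing
  a competitor \<open>T\<close> by \<open>T \<inter> S\<close> preserves the constraints and does not increase the
  supremum.\<close>

definition weight :: "nat \<Rightarrow> (nat \<Rightarrow> real) set \<Rightarrow> ((nat \<Rightarrow> real) \<Rightarrow> real) \<Rightarrow> (nat \<Rightarrow> real) \<Rightarrow> real"
  where "weight d S G \<xi> = 1 / (normalizer d S G * G \<xi>)"

text \<open>\<open>Y\<close> is the law of the sampled vector, \<open>\<Omega>\<close> the support of the underlying density, \<open>N\<close>
  the number of samples and \<open>K\<close> the index set of the basis functions. Values are in \<^typ>\<open>ennreal\<close>,
  so an unbounded supremum, or the absence of admissible sets, gives \<open>\<infinity>\<close>.\<close>

definition admissible ::
  "'a measure \<Rightarrow> 'a set \<Rightarrow> nat \<Rightarrow> ('a \<Rightarrow> real) \<Rightarrow> 'k set \<Rightarrow> ('k \<Rightarrow> 'a \<Rightarrow> real) \<Rightarrow> 'a set set" where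
  "admissible Y \<Omega> N w K \<phi> = {S \<in> sets Y. S \<subseteq> \<Omega> \<and>
     measure Y (space Y - S) < 1 / (real N * real (card K)) \<and>
     (\<Sum>k\<in>K. \<integral>\<^sup>+\<xi>\<in>(space Y - S). ennreal (\<bar>w \<xi> * \<phi> k \<xi>\<bar>\<^sup>2) \<partial>Y)
       \<le> ennreal (1 / 20 * real (card K) powr (- 1 / 2))}"

definition coherence ::
  "'a measure \<Rightarrow> 'a set \<Rightarrow> nat \<Rightarrow> ('a \<Rightarrow> real) \<Rightarrow> 'k set \<Rightarrow> ('k \<Rightarrow> 'a \<Rightarrow> real) \<Rightarrow> ennreal" where
  "coherence Y \<Omega> N w K \<phi> =
     (INF S\<in>admissible Y \<Omega> N w K \<phi>. SUP k\<in>K. SUP \<xi>\<in>S. ennreal (\<bar>w \<xi> * \<phi> k \<xi>\<bar>\<^sup>2))"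

text \<open>The coherence for Hermite polynomials of total order at most \<open>p\<close> in dimension \<open>d\<close> and
  uniform sampling from the ball of radius \<open>r\<close>. The support of the Gaussian density is
  the set where it does not vanish, i.e. the whole space.\<close>

definition hermite_ball_coherence :: "nat \<Rightarrow> nat \<Rightarrow> nat \<Rightarrow> real \<Rightarrow> ennreal" where
  "hermite_ball_coherence d p N r =
     coherence (uniform_measure (lebesgue_n d) (ball_n d r))
       {\<xi> \<in> space (lebesgue_n d). gauss_density d \<xi> \<noteq> 0} N
       (weight d (ball_n d r) (\<lambda>\<xi>. exp ((L2_set \<xi> {..<d})\<^sup>2 / 4)))
       (multi_indices d p) (psi_n d)"

end

theory Submission
  imports Defs "HOL-Real_Asymp.Real_Asymp"
begin

text \<open>
  On the ball of radius \<open>r\<close> the squared weighted polynomial is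
  \<open>(2 \<pi>)\<^sup>-\<^sup>d\<^sup>/\<^sup>2 V(r,d) \<Prod>\<^sub>i (\<psi>\<^sub>k\<^sub>i(\<xi>\<^sub>i) exp (- \<xi>\<^sub>i\<^sup>2 / 4))\<^sup>2\<close>, a constant times a product of squared
  Hermite functions. Everything rests on the sharp one-dimensional inequality of Indritz,
  \<open>\<bar>\<psi>\<^sub>n(x)\<bar> exp (- x\<^sup>2 / 4) \<le> 1\<close> for all \<open>n\<close> and \<open>x\<close> (lemma \<open>abs_hermite_fun_le_1\<close>). The constant has
  to be \<open>1\<close>: a larger one, such as the constant \<open>1.0864\<close> of Cramer's inequality, would be raised
  to a power growing with \<open>d\<close>, and \<open>d\<close> may tend to infinity. With it the weighted polynomials are
  bounded on the whole space by \<open>(2 \<pi>)\<^sup>-\<^sup>d\<^sup>/\<^sup>2 V(r,d)\<close>, so the whole space can serve as the set in the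
  definition of the coherence: both constraints hold trivially for it. Choosing
  \<open>\<epsilon>\<^sub>p = - 1 / p\<close> gives \<open>r = sqrt 2 * sqrt (2 p)\<close>, for which this bound is exactly
  \<open>\<pi>\<^sup>-\<^sup>d\<^sup>/\<^sup>2 V(sqrt (2 p), d)\<close>.

  The inequality of Indritz is proved by induction on \<open>n\<close>. The Hermite function
  \<open>u = \<psi>\<^sub>n exp (- x\<^sup>2 / 4)\<close> vanishes at infinity, so \<open>\<bar>u\<bar>\<close> has a maximum, at \<open>X \<ge> 0\<close> say. There \<open>u' = 0\<close>, and
  the lowering relation \<open>u\<^sub>n' = sqrt n u\<^sub>n\<^sub>-\<^sub>1 - x u\<^sub>n / 2\<close> gives \<open>X u\<^sub>n(X) = 2 sqrt n u\<^sub>n\<^sub>-\<^sub>1(X)\<close>. If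
  \<open>X \<ge> 2 sqrt n\<close>, the bound for \<open>n - 1\<close> implies that for \<open>n\<close>. Otherwise \<open>X\<close> stays away from the
  turning point of the equation \<open>u'' + Q u = 0\<close>, \<open>Q = n + 1/2 - x\<^sup>2 / 4\<close>: one has \<open>Q > 1/2\<close> on
  \<open>[0, X]\<close>. There a Sonin-type energy that decreases in \<open>x\<close> (lemma \<open>sonin_energy_antimono\<close>) controls
  \<open>u(X)\<close> by the values at \<open>0\<close>, which are central binomial coefficients.
  The estimates at both ends (lemmas \<open>sonin_energy_0_bound\<close> and \<open>turning_point_bound\<close>) meet at the
  number \<open>13/20\<close>, a little above \<open>2/\<pi>\<close>, the limit of the squared energy at \<open>0\<close> as \<open>n\<close> grows.
\<close>

section \<open>Hermite functions\<close>

text \<open>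
  With respect to Lebesgue measure these functions have norm \<open>(2 \<pi>)\<^sup>1\<^sup>/\<^sup>4\<close>; in this scaling the sharp
  uniform bound is \<open>1\<close>, the value of \<open>hermite_fun 0\<close> at \<open>0\<close>.
\<close>

definition hermite_fun :: "nat \<Rightarrow> real \<Rightarrow> real" where
  "hermite_fun n x = exp (- (x\<^sup>2 / 4)) * psi n x"

lemma psi_three_term:
  "sqrt (real (Suc (Suc n))) * psi (Suc (Suc n)) x = x * psi (Suc n) x - sqrt (real (Suc n)) * psi n x"
proof -
  define A B where "A = sqrt (real (Suc n))" and "B = sqrt (real (Suc (Suc n)))"
  have A: "A > 0" "real (Suc n) = A * A" and B: "B > 0" by (simp_all add: A_def B_def)
  have f: "sqrt (fact (Suc n)) = A * sqrt (fact n)"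
    "sqrt (fact (Suc (Suc n))) = B * (A * sqrt (fact n))"
    by (simp_all only: A_def B_def fact_Suc real_sqrt_mult of_nat_mult)
  have "poly (Hermite (Suc (Suc n))) x = x * poly (Hermite (Suc n)) x - A * A * poly (Hermite n) x"
    by (simp add: A(2)[symmetric])
  then show ?thesis
    unfolding psi_def f A_def[symmetric] B_def[symmetric] using A B
    by (simp add: field_simps)
qed

lemma psi_has_deriv:
  "(psi (Suc n) has_real_derivative sqrt (real (Suc n)) * psi n x) (at x)"
proof -
  define A where "A = sqrt (real (Suc n))"
  have A: "A > 0" "real (Suc n) = A * A" by (simp_all add: A_def)
  have f: "sqrt (fact (Suc n)) = A * sqrt (fact n)"
    by (simp only: A_def fact_Suc real_sqrt_mult of_nat_mult)
  have "((\<lambda>x. poly (Hermite (Suc n)) x / sqrt (fact (Suc n))) has_real_derivative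
      poly (pderiv (Hermite (Suc n))) x / sqrt (fact (Suc n))) (at x)"
    by (intro DERIV_cdivide poly_DERIV)
  also have "poly (pderiv (Hermite (Suc n))) x / sqrt (fact (Suc n)) = A * psi n x"
    unfolding pderiv_Hermite psi_def f poly_smult A(2) using A(1) by (simp add: field_simps)
  finally show ?thesis unfolding A_def psi_def .
qed

lemma hermite_fun_deriv_lower:
  "(hermite_fun (Suc n) has_real_derivative
     sqrt (real (Suc n)) * hermite_fun n x - x / 2 * hermite_fun (Suc n) x) (at x)"
  unfolding hermite_fun_def
  by (rule derivative_eq_intros psi_has_deriv refl | simp)+

lemma hermite_fun_deriv_raise:
  "(hermite_fun n has_real_derivative
     x / 2 * hermite_fun n x - sqrt (real (Suc n)) * hermite_fun (Suc n) x) (at x)"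
proof (cases n)
  case 0
  have [simp]: "psi 0 x = 1" "psi (Suc 0) x = x" for x by (simp_all add: psi_def)
  show ?thesis unfolding 0 hermite_fun_def
    by (simp, (rule derivative_eq_intros refl | simp)+)
next
  case (Suc m)
  have eq: "sqrt (real (Suc n)) * hermite_fun (Suc n) x
      = x * hermite_fun n x - sqrt (real n) * hermite_fun m x"
  proof -
    have "sqrt (real (Suc n)) * hermite_fun (Suc n) x
        = exp (- (x\<^sup>2 / 4)) * (sqrt (real (Suc n)) * psi (Suc n) x)"
      by (simp add: hermite_fun_def)
    also have "\<dots> = exp (- (x\<^sup>2 / 4)) * (x * psi n x - sqrt (real n) * psi m x)"
      unfolding Suc psi_three_term ..
    finally show ?thesis by (simp add: hermite_fun_def algebra_simps)
  qed
  show ?thesis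
    using hermite_fun_deriv_lower[of m x] unfolding eq Suc[symmetric]
    by (simp add: field_simps)
qed

lemma psi_minus: "psi n (- x) = (- 1) ^ n * psi n x"
proof -
  have "poly (Hermite n) (- x) = (- 1) ^ n * poly (Hermite n) x"
    by (induction n rule: Hermite.induct) (simp_all add: algebra_simps)
  then show ?thesis by (simp add: psi_def)
qed

lemma abs_hermite_fun_minus: "\<bar>hermite_fun n (- x)\<bar> = \<bar>hermite_fun n x\<bar>"
  by (simp add: hermite_fun_def psi_minus abs_mult power_abs)

lemma hermite_fun_tendsto_0: "(hermite_fun n \<longlongrightarrow> 0) at_top"
proof -
  have "((\<lambda>x. \<Sum>i\<le>degree (Hermite n). coeff (Hermite n) i * (exp (- (x\<^sup>2 / 4)) * x ^ i)) \<longlongrightarrow>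
      (\<Sum>i\<le>degree (Hermite n). coeff (Hermite n) i * 0)) at_top"
  proof (intro tendsto_sum tendsto_mult tendsto_const)
    fix i :: nat
    show "((\<lambda>x::real. exp (- (x\<^sup>2 / 4)) * x ^ i) \<longlongrightarrow> 0) at_top" by real_asymp
  qed
  then have "((\<lambda>x. exp (- (x\<^sup>2 / 4)) * poly (Hermite n) x / sqrt (fact n)) \<longlongrightarrow> 0 / sqrt (fact n)) at_top"
    by (intro tendsto_divide tendsto_const) (simp_all add: poly_altdef sum_distrib_left mult_ac)
  then show ?thesis
    by (simp add: hermite_fun_def[abs_def] psi_def)
qed

section \<open>A Sonin-type energy\<close>

text \<open>
  The Liouville transformation \<open>w = Q\<^sup>1\<^sup>/\<^sup>4 u\<close>, \<open>d\<tau> = sqrt Q dx\<close> turns \<open>u'' + Q u = 0\<close> with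
  \<open>Q = n + 1/2 - x\<^sup>2 / 4\<close> into \<open>w'' + (1 + \<rho>) w = 0\<close> (derivatives in \<open>\<tau>\<close>), where
  \<open>1 + \<rho> = (64 Q\<^sup>3 + 8 Q + 5 x\<^sup>2) / (64 Q\<^sup>3)\<close>. The energy below is Sonin's function
  \<open>w\<^sup>2 + w'\<^sup>2 / (1 + \<rho>)\<close> of the transformed equation, written in terms of \<open>u\<close> and \<open>du/dx\<close>. Its derivative
  is \<open>- \<rho>' (w' / (1 + \<rho>))\<^sup>2\<close>, and \<open>\<rho>\<close> increases for \<open>x \<ge> 0\<close>. The factor \<open>sqrt Q\<close> matches
  the growth of the amplitude of \<open>u\<close> towards the turning point. The energies of the untransformed
  equation are too crude there: \<open>u\<^sup>2 + u'\<^sup>2 / Q\<close> increases with \<open>x\<close>, and the decrease of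
  \<open>Q u\<^sup>2 + u'\<^sup>2\<close> only bounds \<open>u\<^sup>2\<close> by a multiple of \<open>sqrt n / Q\<close>.
\<close>

definition sonin_energy :: "nat \<Rightarrow> (real \<Rightarrow> real) \<Rightarrow> (real \<Rightarrow> real) \<Rightarrow> real \<Rightarrow> real" where
  "sonin_energy n u u' x =
     (let Q = real n + 1 / 2 - x\<^sup>2 / 4
      in sqrt Q * ((u x)\<^sup>2 + (8 * Q * u' x - x * u x)\<^sup>2 / (64 * Q ^ 3 + 8 * Q + 5 * x\<^sup>2)))"

text \<open>
  The derivative of \<open>sqrt Q (u\<^sup>2 + v\<^sup>2 / D)\<close> collapses to a single square: with \<open>s = sqrt Q\<close>, \<open>a = u\<close>
  and \<open>v = 8 Q u' - x u\<close> one has \<open>u' = (v + x u) / (8 Q)\<close> and \<open>v' = - (5 x v + D u) / (8 Q)\<close>, so all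
  terms in \<open>a\<^sup>2\<close> and \<open>a v\<close> cancel.
\<close>

lemma sonin_derivative_identity:
  fixes a v x s D D' :: real
  assumes "s > 0" "D > 0"
  shows "- x / (4 * s) * (a\<^sup>2 + v\<^sup>2 / D) + s * (2 * a * ((v + x * a) / (8 * s\<^sup>2))
       + (2 * v * (- (5 * x * v + D * a) / (8 * s\<^sup>2)) * D - v\<^sup>2 * D') / D\<^sup>2)
     = - (v\<^sup>2 * (6 * x * D + 4 * s\<^sup>2 * D')) / (4 * s * D\<^sup>2)"
proof -
  have 1: "s * (2 * a * ((v + x * a) / (8 * s\<^sup>2))) = a * (v + x * a) / (4 * s)"
    using assms by (simp add: power2_eq_square)
  have 2: "s * ((2 * v * (- (5 * x * v + D * a) / (8 * s\<^sup>2)) * D - v\<^sup>2 * D') / D\<^sup>2)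
     = - (v * (5 * x * v + D * a)) / (4 * s * D) - s * v\<^sup>2 * D' / D\<^sup>2"
    using assms by (simp add: diff_divide_distrib power2_eq_square) (simp add: field_simps)
  show ?thesis
    unfolding distrib_left[of s] 1 2 using assms
    by (simp add: divide_simps) (simp add: algebra_simps power2_eq_square)
qed

lemma sonin_energy_has_deriv:
  fixes u u' :: "real \<Rightarrow> real" and n :: nat and x :: real
  defines "Q \<equiv> real n + 1 / 2 - x\<^sup>2 / 4"
  defines "D \<equiv> 64 * Q ^ 3 + 8 * Q + 5 * x\<^sup>2" and "v \<equiv> 8 * Q * u' x - x * u x"
  assumes u: "(u has_real_derivative u' x) (at x)"
    and u': "(u' has_real_derivative - Q * u x) (at x)"
    and Q: "Q > 0"
  shows "(sonin_energy n u u' has_real_derivative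
    - (v\<^sup>2 * (72 * x * Q + 30 * x ^ 3)) / (4 * sqrt Q * D\<^sup>2)) (at x)"
proof -
  define q where "q = (\<lambda>x::real. real n + 1 / 2 - x\<^sup>2 / 4)"
  define DD where "DD = (\<lambda>x. 64 * q x ^ 3 + 8 * q x + 5 * x\<^sup>2)"
  define vv where "vv = (\<lambda>x. 8 * q x * u' x - x * u x)"
  have at: "q x = Q" "DD x = D" "vv x = v"
    by (simp_all add: q_def Q_def DD_def D_def vv_def v_def)
  have D: "D > 0" using Q unfolding D_def by (simp add: add_pos_nonneg)
  have dq: "(q has_real_derivative - x / 2) (at x)"
    unfolding q_def by (rule derivative_eq_intros refl | simp)+
  have dD: "(DD has_real_derivative - 96 * x * Q\<^sup>2 + 6 * x) (at x)"
    unfolding DD_def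
    by (rule derivative_eq_intros refl dq | simp add: at)+
  have dv: "(vv has_real_derivative - (5 * x * v + D * u x) / (8 * Q)) (at x)"
    unfolding vv_def
    apply (rule derivative_eq_intros refl dq u u')+
    using Q by (simp add: at v_def D_def field_simps power2_eq_square power3_eq_cube)
  have du: "(u has_real_derivative (v + x * u x) / (8 * Q)) (at x)"
    using u Q by (simp add: v_def)
  have dsq: "((\<lambda>x. sqrt (q x)) has_real_derivative - x / (4 * sqrt Q)) (at x)"
    by (rule derivative_eq_intros refl dq | use Q in \<open>simp add: at field_simps\<close>)+
  define s where "s = sqrt Q"
  have s: "s > 0" "Q = s * s" using Q by (simp_all add: s_def)
  have "((\<lambda>x. (u x)\<^sup>2 + (vv x)\<^sup>2 / DD x) has_real_derivative
     2 * u x * ((v + x * u x) / (8 * Q))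
       + (2 * v * (- (5 * x * v + D * u x) / (8 * Q)) * D - v\<^sup>2 * (- 96 * x * Q\<^sup>2 + 6 * x)) / D\<^sup>2) (at x)"
    using DERIV_add[OF DERIV_power[OF du, of 2] DERIV_divide[OF DERIV_power[OF dv, of 2] dD]] D
    by (simp only: at power2_eq_square) (simp add: mult_ac)
  from DERIV_mult[OF dsq this]
  have "((\<lambda>x. sqrt (q x) * ((u x)\<^sup>2 + (vv x)\<^sup>2 / DD x)) has_real_derivative
     - x / (4 * s) * ((u x)\<^sup>2 + v\<^sup>2 / D) + s * (2 * u x * ((v + x * u x) / (8 * Q))
       + (2 * v * (- (5 * x * v + D * u x) / (8 * Q)) * D - v\<^sup>2 * (- 96 * x * Q\<^sup>2 + 6 * x)) / D\<^sup>2)) (at x)"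
    unfolding at s_def[symmetric] by (simp only: add.commute mult.commute)
  also have "- x / (4 * s) * ((u x)\<^sup>2 + v\<^sup>2 / D) + s * (2 * u x * ((v + x * u x) / (8 * Q))
       + (2 * v * (- (5 * x * v + D * u x) / (8 * Q)) * D - v\<^sup>2 * (- 96 * x * Q\<^sup>2 + 6 * x)) / D\<^sup>2)
     = - (v\<^sup>2 * (6 * x * D + 4 * Q * (- 96 * x * Q\<^sup>2 + 6 * x))) / (4 * s * D\<^sup>2)"
    unfolding s(2) power2_eq_square[of s, symmetric] by (rule sonin_derivative_identity[OF s(1) D])
  also have "6 * x * D + 4 * Q * (- 96 * x * Q\<^sup>2 + 6 * x) = 72 * x * Q + 30 * x ^ 3"
    by (simp add: D_def field_simps power2_eq_square power3_eq_cube)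
  finally show ?thesis
    unfolding s_def sonin_energy_def Let_def vv_def DD_def q_def .
qed

lemma sonin_energy_antimono:
  fixes u u' :: "real \<Rightarrow> real"
  assumes u: "\<And>x. (u has_real_derivative u' x) (at x)"
    and u': "\<And>x. (u' has_real_derivative - (real n + 1 / 2 - x\<^sup>2 / 4) * u x) (at x)"
    and X: "0 \<le> X" "X\<^sup>2 / 4 < real n + 1 / 2"
  shows "sonin_energy n u u' X \<le> sonin_energy n u u' 0"
proof (rule DERIV_nonpos_imp_nonincreasing[OF X(1)], goal_cases)
  case (1 x)
  define Q where "Q = real n + 1 / 2 - x\<^sup>2 / 4"
  have "x\<^sup>2 \<le> X\<^sup>2" using 1 by (intro power_mono) auto
  then have Q: "Q > 0" using X(2) unfolding Q_def by linarith
  have *: "0 \<le> 72 * x * Q + 30 * x ^ 3" using Q 1 by simp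
  show ?case
  proof (intro exI conjI)
    show "(sonin_energy n u u' has_real_derivative
        - ((8 * Q * u' x - x * u x)\<^sup>2 * (72 * x * Q + 30 * x ^ 3)) /
          (4 * sqrt Q * (64 * Q ^ 3 + 8 * Q + 5 * x\<^sup>2)\<^sup>2)) (at x)"
      using Q unfolding Q_def by (intro sonin_energy_has_deriv u u')
    show "- ((8 * Q * u' x - x * u x)\<^sup>2 * (72 * x * Q + 30 * x ^ 3)) /
          (4 * sqrt Q * (64 * Q ^ 3 + 8 * Q + 5 * x\<^sup>2)\<^sup>2) \<le> 0"
      using Q by (intro divide_nonpos_nonneg iffD2[OF neg_le_0_iff_le] mult_nonneg_nonneg *) auto
  qed
qed

section \<open>The sharp uniform bound for Hermite functions\<close>

lemma psi_at_0_Suc_Suc: "(psi (Suc (Suc n)) 0)\<^sup>2 = real (Suc n) / real (Suc (Suc n)) * (psi n 0)\<^sup>2"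
proof -
  have "(sqrt (real (Suc (Suc n))) * psi (Suc (Suc n)) 0)\<^sup>2 = (sqrt (real (Suc n)) * psi n 0)\<^sup>2"
    unfolding psi_three_term by simp
  then have "real (Suc (Suc n)) * (psi (Suc (Suc n)) 0)\<^sup>2 = real (Suc n) * (psi n 0)\<^sup>2"
    by (simp add: power_mult_distrib)
  then show ?thesis by (simp add: field_simps del: of_nat_Suc)
qed

lemma psi_odd_at_0: "odd n \<Longrightarrow> psi n 0 = 0"
  using psi_minus[of n 0] by simp

text \<open>
  For even \<open>n\<close> the square of \<open>psi n 0\<close> is the central binomial coefficient of \<open>n\<close> over \<open>n/2\<close> divided by
  \<open>2\<^sup>n\<close>, so the fourth power is asymptotically \<open>2 / (\<pi> n)\<close>. The shift \<open>3/5\<close> is chosen so that the left-hand side is decreasing from \<open>n = 2\<close> on,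
  where its value is \<open>13/20\<close>; a shift of \<open>1/2\<close> would make it increase to \<open>2/\<pi>\<close>.
\<close>

lemma psi_even_at_0_bound:
  assumes "even n" "n \<ge> 2"
  shows "(psi n 0) ^ 4 * (real n + 3 / 5) \<le> 13 / 20"
proof -
  have "(psi (2 * Suc m) 0) ^ 4 * (real (2 * Suc m) + 3 / 5) \<le> 13 / 20" for m
  proof (induction m)
    case 0
    have "(psi 0 0)\<^sup>2 = 1" by (simp add: psi_def)
    then have half: "(psi 2 0)\<^sup>2 = 1 / 2"
      using psi_at_0_Suc_Suc[of 0] by (simp add: numeral_2_eq_2)
    have "psi 2 0 ^ 4 = ((psi 2 0)\<^sup>2)\<^sup>2" by (simp flip: power_mult)
    also have "\<dots> = 1 / 4" unfolding half by (simp add: power_divide)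
    finally show ?case by simp
  next
    case (Suc m)
    define t where "t = real (2 * Suc m)"
    define y where "y = (psi (2 * Suc m) 0) ^ 4"
    have t: "t \<ge> 2" by (simp add: t_def)
    have y: "y \<ge> 0" by (simp add: y_def)
    have t12: "real (Suc (2 * Suc m)) = t + 1" "real (Suc (Suc (2 * Suc m))) = t + 2"
      by (simp_all add: t_def)
    have sq: "z ^ 4 = (z\<^sup>2)\<^sup>2" for z :: real by (simp flip: power_mult)
    have "(psi (Suc (Suc (2 * Suc m))) 0) ^ 4 = ((t + 1) / (t + 2))\<^sup>2 * y"
      unfolding sq psi_at_0_Suc_Suc t12 y_def power_mult_distrib ..
    then have e: "(psi (2 * Suc (Suc m)) 0) ^ 4 = ((t + 1) / (t + 2))\<^sup>2 * y"
      by simp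
    have "(t + 2)\<^sup>2 * (t + 3 / 5) - (t + 1)\<^sup>2 * (t + 2 + 3 / 5) = (t - 1) / 5"
      by (simp add: power2_eq_square field_simps)
    moreover have "0 \<le> (t - 1) / 5" using t by simp
    ultimately have "(t + 1)\<^sup>2 * (t + 2 + 3 / 5) \<le> (t + 2)\<^sup>2 * (t + 3 / 5)"
      by (metis diff_ge_0_iff_ge)
    then have "((t + 1) / (t + 2))\<^sup>2 * (t + 2 + 3 / 5) \<le> t + 3 / 5"
      using t by (simp add: power_divide field_simps)
    then have "((t + 1) / (t + 2))\<^sup>2 * y * (t + 2 + 3 / 5) \<le> y * (t + 3 / 5)"
      using mult_left_mono[OF _ y] by (metis mult.assoc mult.commute)
    also have "\<dots> \<le> 13 / 20" using Suc.IH by (simp add: t_def y_def)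
    finally show ?case unfolding e by (simp add: t_def)
  qed
  moreover obtain m where "n = 2 * Suc m"
    using assms by (metis Suc_le_D dvdE mult_0_right not_less_eq_eq numeral_2_eq_2 old.nat.exhaust zero_le)
  ultimately show ?thesis by simp
qed

text \<open>
  At \<open>0\<close> only one of \<open>u\<close> and \<open>u'\<close> is nonzero, depending on the parity of the index, and it is
  given by the value at \<open>0\<close> of the Hermite polynomial of even index.
\<close>

lemma sonin_energy_0_bound:
  assumes n: "Suc m \<ge> 2"
    and u: "u 0 = psi (Suc m) 0" and u': "u' 0 = sqrt (real (Suc m)) * psi m 0"
  shows "(sonin_energy (Suc m) u u' 0)\<^sup>2 \<le> 13 / 20"
proof -
  define Q where "Q = real (Suc m) + 1 / 2"
  have Q: "Q > 0" by (simp add: Q_def)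
  have E: "sonin_energy (Suc m) u u' 0
    = sqrt Q * ((u 0)\<^sup>2 + (8 * Q * u' 0)\<^sup>2 / (64 * Q ^ 3 + 8 * Q))"
    by (simp add: sonin_energy_def Let_def Q_def)
  show ?thesis
  proof (cases "even m")
    case False
    then have "(sonin_energy (Suc m) u u' 0)\<^sup>2 = Q * (psi (Suc m) 0) ^ 4"
      unfolding E u u' using Q by (simp add: psi_odd_at_0 power_mult_distrib flip: power_mult)
    also have "\<dots> \<le> (psi (Suc m) 0) ^ 4 * (real (Suc m) + 3 / 5)"
      unfolding Q_def mult.commute[of _ "psi (Suc m) 0 ^ 4"] by (intro mult_left_mono) auto
    also have "\<dots> \<le> 13 / 20" using False n by (intro psi_even_at_0_bound) auto
    finally show ?thesis .
  next
    case True
    then have m: "m \<ge> 2" using n by (cases "m = 1") auto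
    define y where "y = (psi m 0)\<^sup>2"
    have y: "y \<ge> 0" "y\<^sup>2 = psi m 0 ^ 4" by (simp_all add: y_def flip: power_mult)
    have "(8 * Q * u' 0)\<^sup>2 / (64 * Q ^ 3 + 8 * Q) \<le> (8 * Q * u' 0)\<^sup>2 / (64 * Q ^ 3)"
      using Q by (intro divide_left_mono mult_pos_pos add_pos_pos) auto
    also have "\<dots> = real (Suc m) * y / Q"
      unfolding u' y_def using Q
      by (simp add: power_mult_distrib power2_eq_square power3_eq_cube del: of_nat_Suc)
    finally have "sqrt Q * ((8 * Q * u' 0)\<^sup>2 / (64 * Q ^ 3 + 8 * Q)) \<le> sqrt Q * (real (Suc m) * y / Q)"
      by (rule mult_left_mono) (use Q in simp)
    moreover have "psi (Suc m) 0 = 0" using True by (intro psi_odd_at_0) simp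
    ultimately have "sonin_energy (Suc m) u u' 0 \<le> sqrt Q * (real (Suc m) * y / Q)"
      unfolding E u by simp
    moreover have "0 \<le> sonin_energy (Suc m) u u' 0"
      unfolding E using Q by simp
    ultimately have "(sonin_energy (Suc m) u u' 0)\<^sup>2 \<le> (sqrt Q * (real (Suc m) * y / Q))\<^sup>2"
      by (intro power_mono)
    also have "\<dots> = (real (Suc m))\<^sup>2 / Q * y\<^sup>2"
      unfolding power_mult_distrib power_divide real_sqrt_pow2[OF less_imp_le[OF Q]]
      using Q by (simp add: power2_eq_square)
    also have "\<dots> \<le> (real m + 3 / 5) * y\<^sup>2"
    proof (rule mult_right_mono)
      have "(real (Suc m))\<^sup>2 \<le> (real m + 3 / 5) * Q"
        using m by (simp add: Q_def power2_eq_square algebra_simps)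
      then show "(real (Suc m))\<^sup>2 / Q \<le> real m + 3 / 5" using Q by (simp add: field_simps)
    qed simp
    also have "\<dots> \<le> 13 / 20"
      unfolding y using psi_even_at_0_bound[OF True m] by (simp add: mult.commute)
    finally show ?thesis .
  qed
qed

text \<open>
  At a critical point \<open>x\<close> of \<open>u\<close> the squared energy is \<open>u\<^sup>4\<close> times the right-hand side below. For
  \<open>Q \<ge> 13/20\<close> the factor \<open>Q\<close> alone suffices. Closer to the turning point the contribution \<open>x\<^sup>2 / D\<close> of
  the derivative of the transformed function is needed; it increases with \<open>n\<close>, to \<open>1/5\<close>, and
  the values \<open>36/250\<close> and \<open>12/100\<close> in the proof are lower bounds for it when \<open>n = 2\<close> and
  \<open>Q \<le> 11/20\<close> or \<open>Q \<le> 13/20\<close>.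
\<close>

lemma turning_point_bound:
  fixes Q :: real
  assumes n: "n \<ge> 2" and Q: "1 / 2 \<le> Q" and x: "x\<^sup>2 / 4 = real n + 1 / 2 - Q"
  shows "13 / 20 \<le> Q * (1 + x\<^sup>2 / (64 * Q ^ 3 + 8 * Q + 5 * x\<^sup>2))\<^sup>2"
proof -
  define D where "D = 64 * Q ^ 3 + 8 * Q + 5 * x\<^sup>2"
  have D: "D > 0" using Q unfolding D_def by (intro add_pos_nonneg add_pos_pos) auto
  have *: "13 / 20 \<le> Q * (1 + x\<^sup>2 / D)\<^sup>2"
    if "q \<le> Q" "q > 0" "c > 0" "13 / 20 \<le> q * (1 + c)\<^sup>2" "c * D \<le> x\<^sup>2" for q c :: real
  proof -
    have "c \<le> x\<^sup>2 / D" using that D by (simp add: field_simps)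
    then have "(1 + c)\<^sup>2 \<le> (1 + x\<^sup>2 / D)\<^sup>2" using that by (intro power_mono) auto
    then have "q * (1 + c)\<^sup>2 \<le> Q * (1 + x\<^sup>2 / D)\<^sup>2" using that by (intro mult_mono) auto
    then show ?thesis using that by linarith
  qed
  have cD: "c * D \<le> x\<^sup>2"
    if "Q \<le> r" "c > 0" "c < 1 / 5" "c * (64 * r ^ 3 + 8 * r) \<le> 4 * (5 / 2 - r) * (1 - 5 * c)" for r c
  proof -
    have "Q ^ 3 \<le> r ^ 3" using that Q by (intro power_mono) auto
    then have "c * (64 * Q ^ 3 + 8 * Q) \<le> c * (64 * r ^ 3 + 8 * r)" using that by (intro mult_left_mono) auto
    also note that(4)
    also have "4 * (5 / 2 - r) * (1 - 5 * c) \<le> x\<^sup>2 * (1 - 5 * c)"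
      using n x that by (intro mult_right_mono) auto
    finally show ?thesis unfolding D_def by (simp add: algebra_simps)
  qed
  consider "Q \<le> 11 / 20" | "11 / 20 \<le> Q" "Q \<le> 13 / 20" | "13 / 20 \<le> Q" by linarith
  then have "13 / 20 \<le> Q * (1 + x\<^sup>2 / D)\<^sup>2"
  proof cases
    case 1
    show ?thesis using Q cD[OF 1, of "36 / 250"]
      by (intro *[of "1 / 2" "36 / 250"]) (auto simp: power2_eq_square power3_eq_cube)
  next
    case 2
    show ?thesis using 2 cD[OF 2(2), of "12 / 100"]
      by (intro *[of "11 / 20" "12 / 100"]) (auto simp: power2_eq_square power3_eq_cube)
  next
    case 3
    have "Q * 1 \<le> Q * (1 + x\<^sup>2 / D)\<^sup>2"
      using 3 D by (intro mult_left_mono one_le_power) auto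
    then show ?thesis using 3 by linarith
  qed
  then show ?thesis by (simp add: D_def)
qed

lemma hermite_fun_attains_sup:
  obtains X where "X \<ge> 0" "\<And>x. \<bar>hermite_fun n x\<bar> \<le> \<bar>hermite_fun n X\<bar>"
proof (cases "\<exists>y. hermite_fun n y \<noteq> 0")
  case False
  then show ?thesis by (intro that[of 0]) auto
next
  case True
  have abs_arg: "\<bar>hermite_fun n \<bar>x\<bar>\<bar> = \<bar>hermite_fun n x\<bar>" for x
    using abs_hermite_fun_minus[of n x] by (cases "x \<ge> 0") auto
  obtain y where y: "hermite_fun n y \<noteq> 0" using True by blast
  have "eventually (\<lambda>x. dist (hermite_fun n x) 0 < \<bar>hermite_fun n y\<bar>) at_top"
    using hermite_fun_tendsto_0 y by (intro tendstoD) auto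
  then obtain B where B: "\<And>x. x \<ge> B \<Longrightarrow> \<bar>hermite_fun n x\<bar> < \<bar>hermite_fun n y\<bar>"
    by (auto simp: eventually_at_top_linorder)
  define b where "b = max B \<bar>y\<bar>"
  have "continuous_on {0..b} (\<lambda>x. \<bar>hermite_fun n x\<bar>)"
    by (rule continuous_on_rabs, rule DERIV_continuous_on, rule has_field_derivative_at_within,
        rule hermite_fun_deriv_raise)
  then have "\<exists>X\<in>{0..b}. \<forall>x\<in>{0..b}. \<bar>hermite_fun n x\<bar> \<le> \<bar>hermite_fun n X\<bar>"
    by (intro continuous_attains_sup) (auto simp: b_def)
  then obtain X where X: "X \<in> {0..b}" "\<And>x. x \<in> {0..b} \<Longrightarrow> \<bar>hermite_fun n x\<bar> \<le> \<bar>hermite_fun n X\<bar>"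
    by blast
  show ?thesis
  proof (rule that[of X])
    show "X \<ge> 0" using X(1) by simp
    fix x
    show "\<bar>hermite_fun n x\<bar> \<le> \<bar>hermite_fun n X\<bar>"
    proof (cases "\<bar>x\<bar> \<le> b")
      case True
      then show ?thesis using X(2)[of "\<bar>x\<bar>"] by (simp add: abs_arg)
    next
      case False
      then have "\<bar>hermite_fun n x\<bar> < \<bar>hermite_fun n y\<bar>"
        using B[of "\<bar>x\<bar>"] by (simp add: b_def abs_arg)
      also have "\<dots> \<le> \<bar>hermite_fun n X\<bar>"
        using X(2)[of "\<bar>y\<bar>"] by (simp add: b_def abs_arg)
      finally show ?thesis by simp
    qed
  qed
qed

text \<open>
  Indritz's inequality. The case \<open>n = 1\<close> is separate because the estimate near the turning point
  holds only from \<open>n = 2\<close> on.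
\<close>

lemma abs_hermite_fun_le_1: "\<bar>hermite_fun n x\<bar> \<le> 1"
proof (induction n arbitrary: x)
  case 0
  show ?case by (simp add: hermite_fun_def psi_def)
next
  case (Suc m)
  define n where "n = Suc m"
  define u where "u = hermite_fun n"
  define b where "b = (\<lambda>x. sqrt (real n) * hermite_fun m x)"
  define u' where "u' = (\<lambda>x. b x - x / 2 * u x)"
  have du: "(u has_real_derivative u' x) (at x)" for x
    unfolding u_def u'_def b_def n_def by (rule hermite_fun_deriv_lower)
  obtain X where X: "X \<ge> 0" "\<And>x. \<bar>u x\<bar> \<le> \<bar>u X\<bar>"
    using hermite_fun_attains_sup[of n] unfolding u_def by blast
  have crit: "u' X = 0"
  proof -
    \<comment> \<open>\<open>u\<^sup>2\<close> is smooth, unlike \<open>\<bar>u\<bar>\<close>, and has the same maxima\<close>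
    have "((\<lambda>x. (u x)\<^sup>2) has_real_derivative 2 * u X * u' X) (at X)"
      by (rule derivative_eq_intros du refl | simp)+
    moreover have "(u x)\<^sup>2 \<le> (u X)\<^sup>2" for x
      using X(2) by (simp add: abs_le_square_iff)
    ultimately have "2 * u X * u' X = 0"
      by (intro DERIV_local_max[of "\<lambda>x. (u x)\<^sup>2" _ X 1]) auto
    moreover have "u' X = 0" if "u X = 0"
    proof -
      have "u = (\<lambda>_. 0)" using X(2) that by (intro ext) simp
      then have "(u has_real_derivative 0) (at X)" by simp
      then show ?thesis using DERIV_unique du by blast
    qed
    ultimately show ?thesis by auto
  qed
  have "\<bar>u X\<bar> \<le> 1"
  proof (cases "n = 1")
    case True
    have "\<bar>X\<bar> \<le> exp (X\<^sup>2 / 4)"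
    proof -
      have "\<bar>X\<bar> \<le> 1 + X\<^sup>2 / 4"
        using zero_le_power2[of "\<bar>X\<bar> / 2 - 1"] by (simp add: power2_eq_square field_simps)
      also have "\<dots> \<le> exp (X\<^sup>2 / 4)" by (rule exp_ge_add_one_self)
      finally show ?thesis .
    qed
    then show ?thesis using True
      by (simp add: u_def hermite_fun_def psi_def exp_minus abs_mult field_simps)
  next
    case False
    then have n2: "n \<ge> 2" by (simp add: n_def)
    show ?thesis
    proof (cases "X\<^sup>2 / 4 < real n")
      case False
      \<comment> \<open>far out, the critical point equation reduces the claim to the index \<open>m = n - 1\<close>\<close>
      have "X / 2 * u X = sqrt (real n) * hermite_fun m X"
        using crit by (simp add: u'_def b_def)
      from arg_cong[OF this, of abs]
      have "\<bar>X / 2\<bar> * \<bar>u X\<bar> = sqrt (real n) * \<bar>hermite_fun m X\<bar>"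
        unfolding abs_mult by simp
      also have "\<dots> \<le> sqrt (real n) * 1" by (intro mult_left_mono Suc.IH) simp
      also have "\<dots> \<le> \<bar>X / 2\<bar> * 1"
        unfolding mult_1_right by (rule real_le_lsqrt) (use False in \<open>simp_all add: power_divide\<close>)
      finally have "\<bar>X / 2\<bar> * \<bar>u X\<bar> \<le> \<bar>X / 2\<bar> * 1" .
      moreover have "\<bar>X / 2\<bar> > 0" using False n2 by (cases "X = 0") auto
      ultimately show ?thesis by (simp only: mult_le_cancel_left_pos)
    next
      case True
      \<comment> \<open>in the oscillatory range, the energies at \<open>X\<close> and at \<open>0\<close> are compared\<close>
      define Q where "Q = real n + 1 / 2 - X\<^sup>2 / 4"
      define E where "E = 1 + X\<^sup>2 / (64 * Q ^ 3 + 8 * Q + 5 * X\<^sup>2)"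
      have Q: "Q \<ge> 1 / 2" using True by (simp add: Q_def)
      have du': "(u' has_real_derivative - (real n + 1 / 2 - x\<^sup>2 / 4) * u x) (at x)" for x
      proof -
        have "sqrt (real n) * (x / 2 * hermite_fun m x - sqrt (real n) * u x)
            = x / 2 * b x - (sqrt (real n) * sqrt (real n)) * u x"
          unfolding b_def by (simp only: right_diff_distrib mult_ac)
        moreover have "(b has_real_derivative
            sqrt (real n) * (x / 2 * hermite_fun m x - sqrt (real n) * u x)) (at x)"
          unfolding b_def u_def n_def by (intro DERIV_cmult hermite_fun_deriv_raise)
        ultimately have "(b has_real_derivative x / 2 * b x - real n * u x) (at x)"
          by simp
        from DERIV_diff[OF this DERIV_mult[OF DERIV_cdivide[OF DERIV_ident, of 2] du]]
        have "(u' has_real_derivative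
            x / 2 * b x - real n * u x - (1 / 2 * u x + u' x * (x / 2))) (at x)"
          unfolding u'_def .
        moreover have "x / 2 * b x - real n * u x - (1 / 2 * u x + u' x * (x / 2))
            = - (real n + 1 / 2 - x\<^sup>2 / 4) * u x"
          unfolding u'_def power2_eq_square by (simp add: algebra_simps)
        ultimately show ?thesis by simp
      qed
      have EQ: "sonin_energy n u u' X = sqrt Q * ((u X)\<^sup>2 * E)"
        unfolding sonin_energy_def Let_def Q_def[symmetric] E_def crit
        by (simp add: power_mult_distrib algebra_simps)
      have E: "E \<ge> 1" unfolding E_def using Q by simp
      have "(sonin_energy n u u' X)\<^sup>2 \<le> (sonin_energy n u u' 0)\<^sup>2"
      proof (rule power_mono)
        show "sonin_energy n u u' X \<le> sonin_energy n u u' 0"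
          using True X(1) by (intro sonin_energy_antimono du du') auto
        show "0 \<le> sonin_energy n u u' X" unfolding EQ using Q E by simp
      qed
      also have "\<dots> \<le> 13 / 20"
        unfolding n_def using n2
        by (intro sonin_energy_0_bound) (simp_all add: n_def u_def u'_def b_def hermite_fun_def)
      also have "\<dots> \<le> Q * E\<^sup>2"
        unfolding E_def by (rule turning_point_bound[OF n2 Q]) (simp add: Q_def)
      also have "(sonin_energy n u u' X)\<^sup>2 = (Q * E\<^sup>2) * (u X) ^ 4"
        unfolding EQ using Q by (simp add: power_mult_distrib flip: power_mult)
      finally have "(Q * E\<^sup>2) * (u X) ^ 4 \<le> (Q * E\<^sup>2) * 1" by simp
      moreover have "Q * E\<^sup>2 > 0" using Q E by simp
      ultimately have "(u X) ^ 4 \<le> 1" by (simp only: mult_le_cancel_left_pos)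
      then show ?thesis using power_le_imp_le_base[of "\<bar>u X\<bar>" 3 1] by simp
    qed
  qed
  then show ?case using X(2)[of x] by (simp add: u_def n_def)
qed

section \<open>Uniform sampling from a ball\<close>

lemma sqrt_power_eq_powr: "x > 0 \<Longrightarrow> sqrt x ^ d = x powr (real d / 2)"
  by (simp add: powr_half_sqrt[symmetric] powr_powr flip: powr_realpow)

lemma emeasure_ball_n:
  assumes "r > 0"
  shows "emeasure (lebesgue_n d) (ball_n d r) = ennreal (ball_vol r d)"
proof -
  have "ball_n d r = {f. sqrt (\<Sum>i\<in>{..<d}. (f i)\<^sup>2) \<le> r} \<inter> space (lebesgue_n d)"
    by (auto simp: ball_n_def L2_set_def)
  moreover have "ball_vol r d = unit_ball_vol (real d) * r ^ d"
    by (simp add: ball_vol_def unit_ball_vol_def power_mult_distrib sqrt_power_eq_powr)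
  ultimately show ?thesis
    using emeasure_cball_aux[of "{..<d}" r] assms by simp
qed

lemma ball_vol_nonneg: "r > 0 \<Longrightarrow> ball_vol r d \<ge> 0"
  by (simp add: ball_vol_def)

lemma ball_n_sets: "ball_n d r \<in> sets (lebesgue_n d)"
  unfolding ball_n_def L2_set_def by measurable

abbreviation exp_quarter :: "nat \<Rightarrow> (nat \<Rightarrow> real) \<Rightarrow> real" where
  "exp_quarter d \<xi> \<equiv> exp ((L2_set \<xi> {..<d})\<^sup>2 / 4)"

lemma normalizer_ball:
  assumes "r > 0"
  shows "normalizer d (ball_n d r) (exp_quarter d)
    = ((2 * pi) powr (- (real d / 2)) * ball_vol r d) powr (- 1 / 2)"
proof -
  have "gauss_density d \<xi> * (exp_quarter d \<xi>)\<^sup>2 = (2 * pi) powr (- (real d / 2))" for \<xi>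
    by (simp add: gauss_density_def flip: exp_double exp_add)
  moreover have "measure (lebesgue_n d) (ball_n d r) = ball_vol r d"
    using emeasure_ball_n[OF assms] ball_vol_nonneg[OF assms] by (simp add: measure_def)
  ultimately show ?thesis
    using emeasure_ball_n[OF assms, of d]
    by (simp add: normalizer_def set_integral_const ball_n_sets mult.commute)
qed

text \<open>
  The exponential weight splits into one factor \<open>exp (- \<xi>\<^sub>i\<^sup>2 / 4)\<close> for each coordinate, so that
  only Hermite functions remain, each bounded by \<open>1\<close>.
\<close>

lemma weighted_psi_n_le:
  assumes "r > 0"
  shows "\<bar>weight d (ball_n d r) (exp_quarter d) \<xi> * psi_n d k \<xi>\<bar>\<^sup>2
    \<le> (2 * pi) powr (- (real d / 2)) * ball_vol r d"
proof -
  define C where "C = (2 * pi) powr (- (real d / 2)) * ball_vol r d"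
  have C: "C \<ge> 0" using ball_vol_nonneg[OF assms] by (simp add: C_def)
  have "- ((L2_set \<xi> {..<d})\<^sup>2 / 4) = (\<Sum>i<d. - ((\<xi> i)\<^sup>2 / 4))"
    by (simp add: L2_set_def sum_nonneg sum_negf sum_divide_distrib)
  then have "exp (- ((L2_set \<xi> {..<d})\<^sup>2 / 4)) = (\<Prod>i<d. exp (- ((\<xi> i)\<^sup>2 / 4)))"
    by (simp only: exp_sum finite_lessThan)
  then have "exp (- ((L2_set \<xi> {..<d})\<^sup>2 / 4)) * psi_n d k \<xi> = (\<Prod>i<d. hermite_fun (k i) (\<xi> i))"
    by (simp only: psi_n_def hermite_fun_def prod.distrib)
  then have "psi_n d k \<xi> / exp_quarter d \<xi> = (\<Prod>i<d. hermite_fun (k i) (\<xi> i))"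
    by (simp add: exp_minus field_simps)
  then have "\<bar>psi_n d k \<xi> / exp_quarter d \<xi>\<bar> \<le> 1"
    by (simp add: abs_prod prod_le_1 abs_hermite_fun_le_1)
  then have 1: "(psi_n d k \<xi> / exp_quarter d \<xi>)\<^sup>2 \<le> 1" by (simp add: abs_square_le_1)
  have "weight d (ball_n d r) (exp_quarter d) \<xi> * psi_n d k \<xi>
      = C powr (1 / 2) * (psi_n d k \<xi> / exp_quarter d \<xi>)"
    unfolding weight_def normalizer_ball[OF assms] C_def[symmetric]
    by (simp add: powr_minus field_simps)
  then have "\<bar>weight d (ball_n d r) (exp_quarter d) \<xi> * psi_n d k \<xi>\<bar>\<^sup>2
      = C * (psi_n d k \<xi> / exp_quarter d \<xi>)\<^sup>2"
    using C by (simp only: power2_abs power_mult_distrib) (simp add: powr_half_sqrt)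
  also have "\<dots> \<le> C" using mult_left_mono[OF 1 C] by simp
  finally show ?thesis unfolding C_def .
qed

text \<open>
  The weighted polynomials are bounded on the whole space, not only on the ball, so the whole space
  is an admissible competitor with empty complement.
\<close>

lemma hermite_ball_coherence_le:
  assumes "r > 0" "N \<ge> 1"
  shows "hermite_ball_coherence d p N r \<le> ennreal ((2 * pi) powr (- (real d / 2)) * ball_vol r d)"
proof -
  let ?S = "space (lebesgue_n d)"
  have "card (multi_indices d p) > 0" by (simp add: card_multi_indices)
  then have "?S \<in> admissible (uniform_measure (lebesgue_n d) (ball_n d r))
      {\<xi> \<in> space (lebesgue_n d). gauss_density d \<xi> \<noteq> 0} N
      (weight d (ball_n d r) (exp_quarter d)) (multi_indices d p) (psi_n d)"
    using assms(2) by (simp add: admissible_def gauss_density_def)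
  then show ?thesis
    unfolding hermite_ball_coherence_def coherence_def
    by (rule INF_lower2) (intro SUP_least ennreal_leI weighted_psi_n_le assms)
qed

theorem theorem4p3:
  fixes d N P :: "nat \<Rightarrow> nat" and k :: real
  assumes dim: "\<And>p. d p \<ge> 1"
    and samples: "\<And>p. N p \<ge> 1"
    and P: "\<And>p. P p = (p + d p) choose (d p)"
    and k: "k > 0"
    and N: "(\<lambda>p. real (N p)) \<in> O(\<lambda>p. real (P p) powr k)"
  shows "\<exists>\<epsilon> :: nat \<Rightarrow> real.
    ((\<lambda>p. real (d p)) \<in> o(\<lambda>p. real p) \<longrightarrow> \<epsilon> \<longlonglongrightarrow> 0) \<and>
    (\<forall>p. (2 + \<epsilon> p) * real p + 1 > 0) \<and>
    (let \<mu> = (\<lambda>p. hermite_ball_coherence (d p) p (N p)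
                    (sqrt 2 * sqrt ((2 + \<epsilon> p) * real p + 1)));
         g = (\<lambda>p. pi powr (- (real (d p) / 2)) * ball_vol (sqrt (2 * real p)) (d p));
         h = (\<lambda>p. (2 * real p) powr (real (d p) / 2) / Gamma (real (d p) / 2 + 1))
     in (\<forall>\<^sub>F p in sequentially. \<mu> p < \<infinity>) \<and>
        (\<lambda>p. enn2real (\<mu> p)) \<in> O(g) \<and> O(g) = O(h))"
proof -
  \<comment> \<open>this choice absorbs the summand \<open>1\<close> in the radius; at \<open>p = 0\<close> it is \<open>0\<close>, and the radius is \<open>sqrt 2\<close>\<close>
  define \<epsilon> :: "nat \<Rightarrow> real" where "\<epsilon> = (\<lambda>p. - 1 / real p)"
  define r where "r = (\<lambda>p. sqrt 2 * sqrt ((2 + \<epsilon> p) * real p + 1))"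
  define \<mu> where "\<mu> = (\<lambda>p. hermite_ball_coherence (d p) p (N p) (r p))"
  define g where "g = (\<lambda>p. pi powr (- (real (d p) / 2)) * ball_vol (sqrt (2 * real p)) (d p))"
  define h where "h = (\<lambda>p. (2 * real p) powr (real (d p) / 2) / Gamma (real (d p) / 2 + 1))"
  have radius: "(2 + \<epsilon> p) * real p + 1 = (if p = 0 then 1 else 2 * real p)" for p
    by (simp add: \<epsilon>_def field_simps)
  have "g p = h p" for p
  proof (cases "p = 0")
    case True
    then show ?thesis using dim[of p] by (simp add: g_def h_def ball_vol_def)
  next
    case False
    then show ?thesis
      by (simp add: g_def h_def ball_vol_def power_mult_distrib sqrt_power_eq_powr powr_minus)
  qed
  then have gh: "g = h" by blast
  have bound: "\<mu> p \<le> ennreal (g p)" "g p \<ge> 0" if "p > 0" for p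
  proof -
    have r: "r p > 0" "r p = sqrt 2 * sqrt (2 * real p)" using that by (simp_all add: r_def radius)
    have "(2 * pi) powr (- (real (d p) / 2)) * ball_vol (r p) (d p) = g p"
      by (simp add: r(2) g_def ball_vol_def power_mult_distrib sqrt_power_eq_powr powr_minus powr_mult)
    then show "\<mu> p \<le> ennreal (g p)"
      using hermite_ball_coherence_le[OF r(1) samples[of p], of "d p" p] by (simp add: \<mu>_def)
    show "g p \<ge> 0" using that by (simp add: g_def ball_vol_nonneg)
  qed
  have "\<epsilon> \<longlonglongrightarrow> 0" unfolding \<epsilon>_def by real_asymp
  moreover have "(2 + \<epsilon> p) * real p + 1 > 0" for p by (simp add: radius)
  moreover have "\<forall>\<^sub>F p in sequentially. \<mu> p < \<infinity>"
    using eventually_gt_at_top[of 0]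
    by eventually_elim (use bound in \<open>auto intro: le_less_trans[OF _ ennreal_less_top]\<close>)
  moreover have "(\<lambda>p. enn2real (\<mu> p)) \<in> O(g)"
  proof (rule bigoI[of _ 1])
    show "\<forall>\<^sub>F p in sequentially. norm (enn2real (\<mu> p)) \<le> 1 * norm (g p)"
      using eventually_gt_at_top[of 0]
      by eventually_elim (use bound in \<open>auto intro: enn2real_leI\<close>)
  qed
  ultimately show ?thesis
    unfolding Let_def by (intro exI[of _ \<epsilon>]) (auto simp: \<mu>_def r_def g_def h_def gh[unfolded g_def h_def])
qed

end
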